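(* For every positive integer $n\ge 1$, the following two identities hold: \[2B_{n}=\sum_{j=0}^{n-1}\frac{(-1)^j}{\binom{2n-1}{j}}\, \left\langle\!\left\langle \begin{smallmatrix} n \\ j \end{smallmatrix} \right\rangle\!\right\rangle,\] \[\sum_{j=1}^n\frac{B_j}{j}= H_{2n} - n +\frac{1}{2n} \sum_{j=1}^{n-1} \frac{(-1)^{j-1}}{\binom{2n-1}{j-1}}\, \left\langle\!\left\langle \begin{smallmatrix} n \\ j \end{smallmatrix} \right\rangle\!\right\rangle,\] where $B_j$ are the Bernoulli numbers (with $B_1=+\tfrac12$), $H_{m}$ is the $m$-th harmonic number, and $\left\langle\!\left\langle \begin{smallmatrix} n \\ j \end{smallmatrix} \right\rangle\!\right\rangle$ are the second Eulerian numbers.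
   Context: Bernoulli numbers: $B_0=1$ and $B_n = 1 - \frac{1}{n+1}\sum_{j=0}^{n-1}\binom{n+1}{j}B_j$ for $n\ge 1$ (so $B_1=1/2$). Harmonic numbers: $H_n=\sum_{j=1}^n \frac1j$ for $n\ge 1$. A Stirling permutation of order $n$ is a permutation $\sigma=\sigma_1\sigma_2\cdots\sigma_{2n}$ of the multiset $\{1,1,2,2,\ldots,n,n\}$ such that for every $i\in\{1,\ldots,n\}$, all elements $s$ appearing between the two occurrences of $i$ satisfy $s>i$. An index $i\in\{1,\ldots,2n-1\}$ is a descent of $\sigma$ if $\sigma_i>\sigma_{i+1}$ (the final index $2n$ is not counted as a descent). The second Eulerian number $\left\langle\!\left\langle \begin{smallmatrix} n \\ k \end{smallmatrix} \right\rangle\!\right\rangle$ is the number of Stirling permutations of order $n$ with exactly $k$ descents. *)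

theory Defs
  imports "HOL-Analysis.Harmonic_Numbers" "HOL-Library.Multiset"
begin

(* The recursion below gives the convention bernoulli 1 = + 1/2. *)
fun bernoulli :: "nat \<Rightarrow> real" where
  "bernoulli 0 = 1"
| "bernoulli (Suc n) =
     1 - (1 / real (Suc n + 1)) * (\<Sum>j = 0..n. real ((Suc n + 1) choose j) * bernoulli j)"

(* Words are lists, with positions counted from 0. Each letter occurs exactly twice, so positions
   i < k with s ! i = s ! k are the two occurrences of that letter. *)
definition stirling_permutation :: "nat \<Rightarrow> nat list \<Rightarrow> bool" where
  "stirling_permutation n s \<longleftrightarrow>
     mset s = mset_set {1..n} + mset_set {1..n} \<and>
     (\<forall>i j k. i < j \<and> j < k \<and> k < length s \<and> s ! i = s ! k \<longrightarrow> s ! j > s ! i)"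

(* The last position is not counted as a descent. *)
definition descents :: "nat list \<Rightarrow> nat set" where
  "descents s = {i. i + 1 < length s \<and> s ! i > s ! (i + 1)}"

definition second_eulerian :: "nat \<Rightarrow> nat \<Rightarrow> nat" where
  "second_eulerian n k = card {s. stirling_permutation n s \<and> card (descents s) = k}"

end

theory Submission
  imports
    Defs
    "HOL-Analysis.Henstock_Kurzweil_Integration"
    "HOL-Computational_Algebra.Polynomial"
    "HOL-Computational_Algebra.Formal_Power_Series"
begin

text \<open>Inserting the two adjacent copies of the largest letter gives the recurrence of the second
  Eulerian numbers. It says that the polynomials
  \<open>A\<^sub>n = \<Sum>j. (-1)\<^sup>j \<langle>\<langle>n, j\<rangle>\<rangle> X\<^bsup>j+1\<^esup> (1 - X)\<^bsup>2n-j\<^esup>\<close> are the iterates of \<open>X\<close> under the derivation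
  \<open>X (1 - X)\<^sup>2 d/dX\<close>. Since \<open>1 / (m choose j)\<close> is \<open>m + 1\<close> times a beta integral, integration by parts
  reduces both identities to \<open>\<integral>\<^sub>0\<^sup>1 A\<^sub>n = B\<^sub>n\<^sub>+\<^sub>1 / (n + 1)\<close>. For the latter, let \<open>F = \<Sum>n. A\<^sub>n s\<^sup>n / n!\<close> and
  let \<open>G\<close> be \<open>1 / (s X)\<close> times the integral of \<open>F\<close> over \<open>[0, s]\<close>. Then \<open>d/dX (1 / G) = s (1 - F)\<close>, while
  \<open>1 / G\<close> is \<open>1\<close> at \<open>X = 1\<close> and \<open>s / (exp s - 1)\<close> at \<open>X = 0\<close>.\<close>

unbundle no vec_syntax
unbundle fps_syntax

section \<open>The recurrence of the second Eulerian numbers\<close>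

definition insert_pair :: "nat \<Rightarrow> nat \<Rightarrow> nat list \<Rightarrow> nat list" where
  "insert_pair a i s = take i s @ [a, a] @ drop i s"

section \<open>Descents and the insertion of two adjacent copies of a largest letter\<close>

lemma descents_Cons_Cons:
  "descents (x # y # s) = (if y < x then {0} else {}) \<union> Suc ` descents (y # s)" (is "?L = ?R")
proof (intro equalityI subsetI)
  fix i assume "i \<in> ?L" then show "i \<in> ?R"
    by (cases i) (auto simp: descents_def)
next
  fix i assume "i \<in> ?R" then show "i \<in> ?L"
    by (auto simp: descents_def split: if_splits)
qed

lemma descents_simps [simp]: "descents [] = {}" "descents [x] = {}"
  by (auto simp: descents_def)

lemma finite_descents [simp]: "finite (descents s)"
  by (rule finite_subset[of _ "{..<length s}"]) (auto simp: descents_def)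

lemma card_descents_Cons_Cons:
  "card (descents (x # y # s)) = (if y < x then 1 else 0) + card (descents (y # s))"
proof -
  have "card ((if y < x then {0} else {}) \<union> Suc ` descents (y # s))
      = card (if y < x then {0::nat} else {}) + card (Suc ` descents (y # s))"
    by (rule card_Un_disjoint) auto
  then show ?thesis
    by (simp add: descents_Cons_Cons card_image)
qed

lemma card_descents_append:
  "card (descents (xs @ ys)) = card (descents xs) + card (descents ys) +
     (if xs \<noteq> [] \<and> ys \<noteq> [] \<and> hd ys < last xs then 1 else 0)"
proof (induction xs rule: induct_list012)
  case 1 then show ?case by simp
next
  case (2 x) then show ?case by (cases ys) (auto simp: card_descents_Cons_Cons)
next
  case (3 x y zs) then show ?case by (simp add: card_descents_Cons_Cons)
qed

text \<open>The pair makes no descent on its left and one on its right, unless it stands at the end.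
  In a gap that was already a descent, the new descent replaces the old one. Gap \<open>i\<close>
  lies before position \<open>i\<close>, so the descent at position \<open>k\<close> is gap
  \<open>Suc k\<close>.\<close>

lemma card_descents_insert_pair:
  assumes "\<And>x. x \<in> set s \<Longrightarrow> x < a" "i \<le> length s"
  shows "card (descents (insert_pair a i s)) =
    (if i \<in> insert (length s) (Suc ` descents s) then card (descents s) else Suc
        (card (descents s)))"
proof -
  define xs ys where "xs = take i s" and "ys = drop i s"
  have s: "s = xs @ ys" and i: "i = length xs"
    using assms(2) by (simp_all add: xs_def ys_def)
  have aa: "card (descents [a, a]) = 0"
    by (simp add: card_descents_Cons_Cons)
  have last: "\<not> a < last xs" if "xs \<noteq> []"
    using assms(1)[of "last xs"] that by (simp add: s)
  have hd: "hd ys < a" if "ys \<noteq> []"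
    using assms(1)[of "hd ys"] that by (simp add: s)
  have "card (descents ([a, a] @ ys)) = card (descents ys) + (if ys = [] then 0 else 1)"
    using hd by (subst card_descents_append) (simp add: aa)
  then have ins: "card (descents (insert_pair a i s))
      = card (descents xs) + card (descents ys) + (if ys = [] then 0 else 1)"
    using last unfolding insert_pair_def xs_def[symmetric] ys_def[symmetric]
    by (subst card_descents_append) auto
  have mem: "i \<in> Suc ` descents s \<longleftrightarrow> xs \<noteq> [] \<and> ys \<noteq> [] \<and> hd ys < last xs"
  proof (cases "xs = [] \<or> ys = []")
    case True then show ?thesis by (auto simp: i s descents_def)
  next
    case False
    then obtain k where k: "length xs = Suc k" by (cases xs) auto
    then have "i \<in> Suc ` descents s \<longleftrightarrow> k \<in> descents s" by (auto simp: i)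
    also have "\<dots> \<longleftrightarrow> hd ys < last xs"
      using False k by (auto simp: descents_def s nth_append last_conv_nth hd_conv_nth)
    finally show ?thesis using False by auto
  qed
  have "i = length s \<longleftrightarrow> ys = []" by (simp add: i s)
  then show ?thesis
    unfolding ins insert_iff mem by (simp add: s card_descents_append)
qed

section \<open>Stirling permutations and their largest letter\<close>

lemma stirling_permutation_length: "stirling_permutation n s \<Longrightarrow> length s = 2 * n"
  unfolding stirling_permutation_def
  by (metis size_mset size_union size_mset_set card_atLeastAtMost diff_Suc_1 mult_2)

lemma stirling_permutation_set: "stirling_permutation n s \<Longrightarrow> set s = {1..n}"
  unfolding stirling_permutation_def
  by (metis set_mset_mset set_mset_union finite_set_mset_mset_set finite_atLeastAtMost sup.idem)

lemma finite_stirling_permutations: "finite {s. stirling_permutation n s}"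
  by (rule finite_subset[OF _ finite_lists_length_eq[of "{1..n}" "2 * n"]])
     (auto dest: stirling_permutation_length stirling_permutation_set)

lemma insert_pair_nth:
  assumes "i \<le> length s" "p < length s"
  shows "s ! p = insert_pair a i s ! (if p < i then p else p + 2)"
  using assms by (auto simp: insert_pair_def nth_append)

lemma insert_pair_nth':
  assumes "i \<le> length s"
  shows "insert_pair a i s ! p = (if p < i then s ! p else if p < i + 2 then a else s ! (p - 2))"
  using assms by (auto simp: insert_pair_def nth_append nth_Cons' numeral_2_eq_2)

lemma stirling_permutation_insert_pair_iff:
  assumes "i \<le> length s"
  shows "stirling_permutation (Suc n) (insert_pair (Suc n) i s) \<longleftrightarrow> stirling_permutation n s"
proof -
  let ?t = "insert_pair (Suc n) i s"
  have "mset ?t = mset s + {#Suc n, Suc n#}"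
    unfolding insert_pair_def by (simp flip: mset_append[of "take i s" "drop i s"])
  moreover have "mset_set {1..Suc n} = add_mset (Suc n) (mset_set {1..n})"
    by (simp add: atLeastAtMostSuc_conv)
  ultimately have mset: "mset ?t = mset_set {1..Suc n} + mset_set {1..Suc n} \<longleftrightarrow>
      mset s = mset_set {1..n} + mset_set {1..n}"
    by simp
  have len: "length ?t = length s + 2"
    using assms by (simp add: insert_pair_def)
  show ?thesis
  proof
    assume t: "stirling_permutation (Suc n) ?t"
    have "s ! p < s ! q" if "p < q" "q < r" "r < length s" "s ! p = s ! r" for p q r
    proof -
      \<comment> \<open>\<open>?e\<close> takes a position of \<open>s\<close> to that of the same
        letter in \<open>?t\<close>. It is strictly monotone, so betweenness is preserved.\<close>
      let ?e = "\<lambda>p. if p < i then p else p + 2"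
      have "?e p < ?e q" "?e q < ?e r" "?e r < length ?t" using that len by auto
      moreover have "?t ! ?e p = ?t ! ?e r"
        using that insert_pair_nth[OF assms, of p "Suc n"] insert_pair_nth[OF assms, of r "Suc n"]
        by simp
      ultimately have "?t ! ?e p < ?t ! ?e q"
        using t unfolding stirling_permutation_def by blast
      then show ?thesis
        using that insert_pair_nth[OF assms, of p "Suc n"] insert_pair_nth[OF assms, of q "Suc n"]
        by simp
    qed
    then show "stirling_permutation n s"
      using t mset unfolding stirling_permutation_def by blast
  next
    assume s: "stirling_permutation n s"
    have small: "s ! p < Suc n" if "p < length s" for p
      using nth_mem[OF that] stirling_permutation_set[OF s] by auto
    have ord: "s ! p < s ! q" if "p < q" "q < r" "r < length s" "s ! p = s ! r" for p q r
      using s that unfolding stirling_permutation_def by blast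
    have "?t ! p < ?t ! q" if *: "p < q" "q < r" "r < length ?t" "?t ! p = ?t ! r" for p q r
    proof (cases "?t ! p = Suc n")
      case True
      \<comment> \<open>The two copies of the largest letter are neighbours, so no \<open>q\<close>
        fits between them.\<close>
      have "k \<in> {i, i + 1}" if "k < length ?t" "?t ! k = Suc n" for k
      proof (rule ccontr)
        assume "k \<notin> {i, i + 1}"
        then have "k < i \<or> i + 2 \<le> k \<and> k - 2 < length s" using that(1) len by auto
        then show False
          using that(2) small[of k] small[of "k - 2"] assms
          by (auto simp: insert_pair_nth'[OF assms])
      qed
      from this[of p] this[of r] show ?thesis using * True by force
    next
      case False
      \<comment> \<open>\<open>?c\<close> maps positions of \<open>?t\<close> other than
        \<open>i\<close> and \<open>i + 1\<close> back to \<open>s\<close>.\<close>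
      let ?c = "\<lambda>p. if p < i then p else p - 2"
      have p: "p < i \<or> i + 2 \<le> p" and r: "r < i \<or> i + 2 \<le> r"
        using False *(4) by (auto simp: insert_pair_nth'[OF assms] split: if_splits)
      have tp: "?t ! p = s ! ?c p" and tr: "?t ! r = s ! ?c r"
        using p r by (auto simp: insert_pair_nth'[OF assms])
      have lt: "?c p < length s" "?c r < length s" using *(1,2,3) len p r assms by auto
      show ?thesis
      proof (cases "q < i \<or> i + 2 \<le> q")
        case True
        then have "?t ! q = s ! ?c q" by (auto simp: insert_pair_nth'[OF assms])
        moreover have "?c p < ?c q" "?c q < ?c r" using True p r *(1,2) by auto
        ultimately show ?thesis using ord[of "?c p" "?c q" "?c r"] lt *(4) tp tr by simp
      next
        case False
        then have "?t ! q = Suc n" by (auto simp: insert_pair_nth'[OF assms])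
        then show ?thesis using small[OF lt(1)] tp by simp
      qed
    qed
    then show "stirling_permutation (Suc n) ?t"
      using s mset unfolding stirling_permutation_def by blast
  qed
qed

text \<open>A letter between the two copies of \<open>Suc n\<close> would have to exceed
  \<open>Suc n\<close>, so the copies are adjacent.\<close>

lemma stirling_permutation_Suc_obtain:
  assumes "stirling_permutation (Suc n) t"
  obtains s i where "i \<le> length s" "t = insert_pair (Suc n) i s"
proof -
  let ?N = "Suc n"
  have "?N \<in> set t" using stirling_permutation_set[OF assms] by auto
  then obtain xs us where t: "t = xs @ ?N # us" and xs: "?N \<notin> set xs"
    by (meson split_list_first)
  have "count (mset t) ?N = 2"
    using assms unfolding stirling_permutation_def by simp
  moreover have "count (mset xs) ?N = 0" using xs by (metis count_mset_0_iff)
  ultimately have "count (mset us) ?N = 1" using t by simp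
  then have "?N \<in> set us" by (metis count_mset_0_iff zero_neq_one)
  then obtain ys zs where us: "us = ys @ ?N # zs" by (meson split_list)
  have "ys = []"
  proof (rule ccontr)
    assume "ys \<noteq> []"
    let ?i = "length xs" and ?k = "length xs + 1 + length ys"
    have "t ! ?i = ?N" "t ! ?k = ?N" "?k < length t"
      by (simp_all add: t us nth_append)
    moreover have "?i < ?i + 1" "?i + 1 < ?k" using \<open>ys \<noteq> []\<close> by simp_all
    ultimately have "?N < t ! (?i + 1)"
      using assms unfolding stirling_permutation_def by metis
    moreover have "t ! (?i + 1) \<in> set t" using \<open>?i + 1 < ?k\<close> \<open>?k < length t\<close> by simp
    ultimately show False using stirling_permutation_set[OF assms] by auto
  qed
  then have "t = insert_pair ?N (length xs) (xs @ zs)"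
    by (simp add: t us insert_pair_def)
  then show thesis by (intro that[of "length xs" "xs @ zs"]) simp_all
qed

text \<open>The prefix before the first \<open>a\<close> recovers the place of insertion, and
  deleting all \<open>a\<close> recovers the word.\<close>

lemma insert_pair_inject:
  assumes eq: "insert_pair a i s = insert_pair a j t"
    and "i \<le> length s" "j \<le> length t" "a \<notin> set s" "a \<notin> set t"
  shows "i = j \<and> s = t"
proof -
  have tw: "takeWhile (\<lambda>x. x \<noteq> a) (insert_pair a k u) = take k u"
    and fl: "filter (\<lambda>x. x \<noteq> a) (insert_pair a k u) = u" if "a \<notin> set u" for k u
  proof -
    have "x \<noteq> a" if "x \<in> set (take k u) \<or> x \<in> set (drop k u)" for x
      using that \<open>a \<notin> set u\<close> by (auto dest: in_set_takeD in_set_dropD)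
    then show "takeWhile (\<lambda>x. x \<noteq> a) (insert_pair a k u) = take k u"
      "filter (\<lambda>x. x \<noteq> a) (insert_pair a k u) = u"
      by (simp_all add: insert_pair_def takeWhile_append2 filter_id_conv[THEN iffD2])
  qed
  have "take i s = take j t" "s = t"
    using tw[of s i] tw[of t j] fl[of s i] fl[of t j] assms by simp_all
  then show ?thesis using assms(2,3) by (metis length_take min.absorb2)
qed

text \<open>Of the \<open>2 * n + 1\<close> gaps of a word with \<open>d\<close> descents,
  \<open>d + 1\<close> keep the number of descents and the other \<open>2 * n - d\<close> raise it
  by one. The two terms count the cases \<open>d = k\<close> and \<open>d = k - 1\<close>.\<close>

lemma second_eulerian_Suc:
  "second_eulerian (Suc n) k = (k + 1) * second_eulerian n k +
     (if k = 0 then 0 else (2 * n + 1 - k) * second_eulerian n (k - 1))"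
proof -
  let ?S = "{s. stirling_permutation n s}" and ?d = "\<lambda>s. card (descents s)"
  let ?I = "\<lambda>s. {i \<in> {..2 * n}. ?d (insert_pair (Suc n) i s) = k}"
  have bij: "bij_betw (\<lambda>(s, i). insert_pair (Suc n) i s) (SIGMA s:?S. ?I s)
      {t. stirling_permutation (Suc n) t \<and> ?d t = k}"
  proof (rule bij_betw_imageI)
    show "inj_on (\<lambda>(s, i). insert_pair (Suc n) i s) (SIGMA s:?S. ?I s)"
    proof (rule inj_onI)
      fix p q assume p: "p \<in> (SIGMA s:?S. ?I s)" and q: "q \<in> (SIGMA s:?S. ?I s)"
        and eq: "(\<lambda>(s, i). insert_pair (Suc n) i s) p = (\<lambda>(s, i). insert_pair (Suc n) i s) q"
      obtain s i t j where pq: "p = (s, i)" "q = (t, j)" by (metis prod.exhaust)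
      have st: "stirling_permutation n s" "stirling_permutation n t" "i \<le> 2 * n" "j \<le> 2 * n"
        using p q unfolding pq by blast+
      then have "i \<le> length s" "j \<le> length t" "Suc n \<notin> set s" "Suc n \<notin> set t"
        by (simp_all add: stirling_permutation_length stirling_permutation_set)
      then show "p = q"
        using insert_pair_inject[of "Suc n" i s j t] eq unfolding pq by simp
    qed
    show "(\<lambda>(s, i). insert_pair (Suc n) i s) ` (SIGMA s:?S. ?I s) =
        {t. stirling_permutation (Suc n) t \<and> ?d t = k}"
    proof (intro equalityI subsetI)
      fix t assume "t \<in> (\<lambda>(s, i). insert_pair (Suc n) i s) ` (SIGMA s:?S. ?I s)"
      then show "t \<in> {t. stirling_permutation (Suc n) t \<and> ?d t = k}"
        by (auto simp: stirling_permutation_insert_pair_iff stirling_permutation_length)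
    next
      fix t assume t: "t \<in> {t. stirling_permutation (Suc n) t \<and> ?d t = k}"
      then obtain s i where si: "i \<le> length s" "t = insert_pair (Suc n) i s"
        using stirling_permutation_Suc_obtain by blast
      with t have "stirling_permutation n s"
        by (simp add: stirling_permutation_insert_pair_iff)
      with si t have "(s, i) \<in> (SIGMA s:?S. ?I s)"
        by (simp add: stirling_permutation_length)
      then show "t \<in> (\<lambda>(s, i). insert_pair (Suc n) i s) ` (SIGMA s:?S. ?I s)"
        using si(2) by (metis (mono_tags, lifting) case_prod_conv image_eqI)
    qed
  qed
  have count: "card (?I s) = (k + 1) * (if ?d s = k then 1 else 0) +
      (if k = 0 then 0 else (2 * n + 1 - k) * (if ?d s = k - 1 then 1 else 0))"
    if s: "stirling_permutation n s" for s
  proof -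
    let ?J = "insert (length s) (Suc ` descents s)"
    have len: "length s = 2 * n" using stirling_permutation_length[OF s] .
    have J: "?J \<subseteq> {..2 * n}" by (auto simp: len descents_def)
    have "length s \<notin> Suc ` descents s" by (auto simp: descents_def)
    then have cJ: "card ?J = ?d s + 1" by (simp add: card_image)
    have cJ': "card ({..2 * n} - ?J) = 2 * n - ?d s"
      using J by (subst card_Diff_subset) (auto simp: cJ simp del: card_insert_disjoint card.insert)
    have "?d (insert_pair (Suc n) i s) = (if i \<in> ?J then ?d s else Suc (?d s))" if "i \<le> 2 * n" for i
      by (rule card_descents_insert_pair) (use that len stirling_permutation_set[OF s] in auto)
    then have "?I s = {i \<in> {..2 * n}. (if i \<in> ?J then ?d s else Suc (?d s)) = k}"
      by auto
    also have "\<dots> = (if ?d s = k then ?J else if Suc (?d s) = k then {..2 * n} - ?J else {})"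
      using J by auto
    finally show ?thesis using cJ cJ' by (auto simp del: card_insert_disjoint card.insert)
  qed
  have fin: "finite ?S" by (rule finite_stirling_permutations)
  have se: "second_eulerian n j = (\<Sum>s\<in>?S. if ?d s = j then 1 else 0)" for j
    using fin by (simp add: second_eulerian_def sum.If_cases Int_def)
  have "second_eulerian (Suc n) k = card (SIGMA s:?S. ?I s)"
    unfolding second_eulerian_def using bij_betw_same_card[OF bij] by simp
  also have "\<dots> = (\<Sum>s\<in>?S. card (?I s))" using fin by (intro card_SigmaI) auto
  also have "\<dots> = (\<Sum>s\<in>?S. (k + 1) * (if ?d s = k then 1 else 0) +
      (if k = 0 then 0 else (2 * n + 1 - k) * (if ?d s = k - 1 then 1 else 0)))"
    by (intro sum.cong refl count) simp
  also have "\<dots> = (k + 1) * second_eulerian n k +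
     (if k = 0 then 0 else (2 * n + 1 - k) * second_eulerian n (k - 1))"
    unfolding sum.distrib se sum_distrib_left by simp
  finally show ?thesis .
qed

lemma second_eulerian_0: "second_eulerian 0 k = (if k = 0 then 1 else 0)"
proof -
  have "stirling_permutation 0 s \<and> card (descents s) = k \<longleftrightarrow> s = [] \<and> k = 0" for s
    by (cases "s = []") (simp_all add: stirling_permutation_def eq_commute[of 0])
  then have "second_eulerian 0 k = card {s :: nat list. s = [] \<and> k = 0}"
    by (simp only: second_eulerian_def)
  then show ?thesis by (cases "k = 0") simp_all
qed

lemma second_eulerian_eq_0: "n < k \<Longrightarrow> second_eulerian n k = 0"
  by (induction n arbitrary: k) (auto simp: second_eulerian_0 second_eulerian_Suc)

text \<open>In the step from \<open>n\<close> to \<open>Suc n\<close> only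
  \<open>n * second_eulerian n n\<close> remains. For \<open>n = 0\<close> the second factor is 1,
  but the first vanishes.\<close>

lemma second_eulerian_same: "n > 0 \<Longrightarrow> second_eulerian n n = 0"
proof (induction n)
  case (Suc n)
  then show ?case
    by (cases n) (auto simp: second_eulerian_0 second_eulerian_Suc second_eulerian_eq_0)
qed simp

lemma second_eulerian_0_right: "second_eulerian n 0 = 1"
  by (induction n) (auto simp: second_eulerian_0 second_eulerian_Suc)

section \<open>Integrals of polynomials over the unit interval\<close>

definition X :: "real poly" where "X = [:0, 1:]"

text \<open>A separate name keeps the beta integrands \<open>X ^ a * Y ^ b\<close> visible as
  monomials.\<close>

definition Y :: "real poly" where "Y = 1 - X"

lemma poly_X [simp]: "poly X a = a" and poly_Y [simp]: "poly Y a = 1 - a"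
  by (simp_all add: X_def Y_def)

lemma pderiv_X [simp]: "pderiv X = 1" and pderiv_Y [simp]: "pderiv Y = - 1"
  by (simp_all add: X_def Y_def pderiv_diff pderiv_pCons one_pCons)

lemma X_neq_0 [simp]: "X \<noteq> 0" and Y_neq_0 [simp]: "Y \<noteq> 0"
  using poly_X[of 1] poly_Y[of 0] by force+

lemma of_nat_mult_poly: "of_nat k * p = smult (real k) (p :: real poly)"
  by (simp add: of_nat_poly)

definition unit_integral :: "real poly \<Rightarrow> real" where
  "unit_integral p = integral {0..1} (poly p)"

lemma poly_integrable: "poly p integrable_on {0..1::real}"
  by (intro integrable_continuous_real continuous_intros)

lemma unit_integral_add: "unit_integral (p + q) = unit_integral p + unit_integral q"
  unfolding unit_integral_def poly_add[abs_def]
  by (rule integral_add[OF poly_integrable poly_integrable])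

lemma unit_integral_diff: "unit_integral (p - q) = unit_integral p - unit_integral q"
  unfolding unit_integral_def poly_diff[abs_def]
  by (rule integral_diff[OF poly_integrable poly_integrable])

lemma unit_integral_smult: "unit_integral (smult c p) = c * unit_integral p"
  unfolding unit_integral_def poly_smult[abs_def] by simp

lemma unit_integral_0: "unit_integral 0 = 0"
  using unit_integral_smult[of 0 0] by simp

lemma unit_integral_sum: "unit_integral (\<Sum>i\<in>A. f i) = (\<Sum>i\<in>A. unit_integral (f i))"
  by (induction A rule: infinite_finite_induct) (simp_all add: unit_integral_add unit_integral_0)

lemma unit_integral_pderiv: "unit_integral (pderiv p) = poly p 1 - poly p 0"
proof -
  have "(poly (pderiv p) has_integral poly p 1 - poly p 0) {0..1}"
    by (intro fundamental_theorem_of_calculus)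
       (auto simp: has_real_derivative_iff_has_vector_derivative[symmetric]
         intro: DERIV_subset[OF poly_DERIV])
  then show ?thesis unfolding unit_integral_def by (rule integral_unique)
qed

text \<open>Integration by parts: \<open>X ^ Suc a * Y ^ Suc b\<close> vanishes at both end points,
  so one factor \<open>X\<close> can be traded for a factor \<open>Y\<close>. The induction on
  \<open>a\<close> therefore needs all \<open>b\<close>.\<close>

lemma unit_integral_beta:
  "unit_integral (X ^ a * Y ^ b) = 1 / (real (a + b + 1) * real ((a + b) choose a))"
proof -
  have "unit_integral (X ^ a * Y ^ b) = fact a * fact b / fact (a + b + 1)"
  proof (induction a arbitrary: b)
    case 0
    have "unit_integral (pderiv (Y ^ Suc b)) = - 1"
      unfolding unit_integral_pderiv by simp
    moreover have "pderiv (Y ^ Suc b) = smult (- (1 + real b)) (Y ^ b)"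
      by (simp only: pderiv_power_Suc pderiv_Y of_nat_Suc mult_minus_right mult_1_right
          smult_minus_left)
    ultimately have "(1 + real b) * unit_integral (Y ^ b) = 1"
      by (simp only: unit_integral_smult)
    then have "unit_integral (Y ^ b) = 1 / (1 + real b)" by (simp add: field_simps)
    then show ?case by (simp add: divide_simps)
  next
    case (Suc a)
    have "unit_integral (pderiv (X ^ Suc a * Y ^ Suc b)) = 0"
      unfolding unit_integral_pderiv by simp
    also have "pderiv (X ^ Suc a * Y ^ Suc b) =
        smult (1 + real a) (X ^ a * Y ^ Suc b) - smult (1 + real b) (X ^ Suc a * Y ^ b)"
      unfolding pderiv_mult pderiv_power_Suc by (simp add: algebra_simps del: power_Suc)
    finally have "(1 + real b) * unit_integral (X ^ Suc a * Y ^ b) =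
        (1 + real a) * (fact a * fact (Suc b) / fact (a + Suc b + 1))"
      by (simp add: unit_integral_smult unit_integral_diff Suc.IH del: power_Suc fact_Suc)
    also have "\<dots> = (1 + real b) * (fact (Suc a) * fact b / fact (Suc a + b + 1))"
      by simp
    finally show ?case
      using of_nat_neq_0[of b, where ?'a = real, unfolded of_nat_Suc]
      by (simp only: mult_cancel_left simp_thms)
  qed
  also have "\<dots> = 1 / (real (a + b + 1) * real ((a + b) choose a))"
    by (simp add: binomial_fact field_simps)
  finally show ?thesis .
qed

section \<open>The generating function of the polynomials\<close>

fun signed_eulerian :: "nat \<Rightarrow> real poly" where
  "signed_eulerian 0 = 1"
| "signed_eulerian (Suc n) = Y ^ 2 * pderiv (X * signed_eulerian n)"

lemma poly_signed_eulerian_0: "poly (signed_eulerian n) 0 = 1"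
  by (induction n) (simp_all add: pderiv_mult)

lemma poly_signed_eulerian_1: "n > 0 \<Longrightarrow> poly (signed_eulerian n) 1 = 0"
  by (cases n) simp_all

section \<open>Power series in \<open>s\<close> over the polynomial ring, with one derivation for
  each variable\<close>

definition fps_pderiv :: "real poly fps \<Rightarrow> real poly fps" where
  "fps_pderiv f = Abs_fps (\<lambda>k. pderiv (f $ k))"

lemma pderiv_sum: "pderiv (\<Sum>i\<in>A. f i) = (\<Sum>i\<in>A. pderiv (f i))"
  by (induction A rule: infinite_finite_induct) (simp_all add: pderiv_add)

lemma fps_pderiv_simps:
  "fps_pderiv (f - g) = fps_pderiv f - fps_pderiv g"
  "fps_pderiv (f * g) = f * fps_pderiv g + fps_pderiv f * g"
  "fps_pderiv 1 = 0" "fps_pderiv fps_X = 0" "fps_pderiv (fps_const c) = fps_const (pderiv c)"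
  subgoal by (simp add: fps_pderiv_def fps_eq_iff pderiv_diff)
  subgoal
    by (simp add: fps_pderiv_def fps_eq_iff fps_mult_nth pderiv_sum pderiv_mult sum.distrib)
       (simp add: mult.commute)
  subgoal by (simp add: fps_pderiv_def fps_eq_iff)
  subgoal by (simp add: fps_pderiv_def fps_eq_iff fps_X_def)
  subgoal by (simp add: fps_pderiv_def fps_eq_iff)
  done

text \<open>The equation determines each coefficient in \<open>s\<close> from the preceding
  one.\<close>

lemma fps_transport_unique:
  assumes "fps_deriv f = fps_const c * fps_pderiv f" "fps_deriv g = fps_const c * fps_pderiv g"
    and "f $ 0 = g $ 0"
  shows "f = g"
proof -
  have "f $ k = g $ k" for k
  proof (induction k)
    case (Suc k)
    have "of_nat (k + 1) * f $ (k + 1) = of_nat (k + 1) * g $ (k + 1)"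
      using arg_cong[OF assms(1), of "\<lambda>h. h $ k"] arg_cong[OF assms(2), of "\<lambda>h. h $ k"] Suc
      by (simp add: fps_pderiv_def)
    then show ?case by (simp del: of_nat_Suc)
  qed (use assms(3) in simp)
  then show ?thesis by (simp add: fps_eq_iff)
qed

lemma fps_linear_ode_zero:
  fixes f h :: "'a :: {idom, ring_char_0} fps"
  assumes "fps_deriv f = h * f" "f $ 0 = 0"
  shows "f = 0"
proof -
  have "f $ k = 0" for k
  proof (induction k rule: less_induct)
    case (less k)
    show ?case
    proof (cases k)
      case (Suc m)
      have "of_nat (m + 1) * f $ (m + 1) = (\<Sum>i=0..m. h $ i * f $ (m - i))"
        using arg_cong[OF assms(1), of "\<lambda>h. h $ m"] by (simp add: fps_mult_nth)
      also have "\<dots> = 0" by (intro sum.neutral) (auto simp: less Suc)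
      finally show ?thesis by (simp add: Suc del: of_nat_Suc)
    qed (use assms(2) in simp)
  qed
  then show ?thesis by (simp add: fps_eq_iff)
qed

text \<open>With \<open>X = w / (1 + w)\<close> and the time \<open>z = w + ln w\<close>, the derivation \<open>X Y\<^sup>2 d/dX\<close> is
  \<open>d/dz\<close>. In these terms \<open>flow_fps\<close> is \<open>X\<close> at time \<open>z + s\<close>, and \<open>increment_fps\<close> below is
  \<open>w(z + s) - w(z)\<close>, where \<open>s\<close> is the power series variable.\<close>

definition flow_fps :: "real poly fps" where
  "flow_fps = Abs_fps (\<lambda>k. smult (1 / fact k) (X * signed_eulerian k))"

text \<open>This is the series \<open>G\<close> of the overview, given by its coefficients so that
  no division by \<open>s X\<close> is needed.\<close>

definition quotient_fps :: "real poly fps" where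
  "quotient_fps = Abs_fps (\<lambda>k. smult (1 / fact (Suc k)) (signed_eulerian k))"

lemma of_nat_mult_smult_fact: "of_nat (Suc k) * smult (1 / fact (Suc k)) (p :: real poly) =
    smult (1 / fact k) p"
  unfolding of_nat_mult_poly by (simp add: divide_simps)

lemma fps_deriv_flow_fps: "fps_deriv flow_fps = fps_const (X * Y ^ 2) * fps_pderiv flow_fps"
  unfolding fps_eq_iff fps_deriv_nth Suc_eq_plus1[symmetric]
  by (simp add: flow_fps_def fps_pderiv_def of_nat_mult_smult_fact[unfolded mult_smult_right]
      pderiv_smult mult.assoc del: of_nat_Suc fact_Suc)

text \<open>Both sides solve the same transport equation: the left because the operator commutes
  with \<open>fps_deriv\<close>, the right by the chain rule. Both start at
  \<open>X * Y ^ 2\<close>.\<close>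

lemma fps_deriv_flow_fps_ode: "fps_deriv flow_fps = flow_fps * (1 - flow_fps) ^ 2"
proof (rule fps_transport_unique[where c = "X * Y ^ 2"])
  show "fps_deriv (fps_deriv flow_fps) = fps_const (X * Y ^ 2) * fps_pderiv (fps_deriv flow_fps)"
  proof -
    have "fps_deriv (fps_const c * fps_pderiv f) = fps_const c * fps_pderiv (fps_deriv f)" for c f
      by (simp add: fps_eq_iff fps_pderiv_def pderiv_mult pderiv_add algebra_simps)
    then show ?thesis by (metis fps_deriv_flow_fps)
  qed
  have "fps_pderiv (flow_fps * (1 - flow_fps) ^ 2) =
      ((1 - flow_fps) ^ 2 - 2 * flow_fps * (1 - flow_fps)) * fps_pderiv flow_fps"
    unfolding power2_eq_square fps_pderiv_simps by (simp add: algebra_simps)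
  moreover have "fps_deriv (flow_fps * (1 - flow_fps) ^ 2) =
      ((1 - flow_fps) ^ 2 - 2 * flow_fps * (1 - flow_fps)) * fps_deriv flow_fps"
    unfolding power2_eq_square by (simp add: algebra_simps)
  ultimately show "fps_deriv (flow_fps * (1 - flow_fps) ^ 2) =
      fps_const (X * Y ^ 2) * fps_pderiv (flow_fps * (1 - flow_fps) ^ 2)"
    by (simp add: fps_deriv_flow_fps mult_ac)
  show "fps_deriv flow_fps $ 0 = (flow_fps * (1 - flow_fps) ^ 2) $ 0"
    by (simp add: flow_fps_def power2_eq_square pderiv_mult Y_def)
qed

definition increment_fps :: "real poly fps" where
  "increment_fps = fps_X * fps_const X * quotient_fps"

lemma increment_fps_nth: "increment_fps $ k =
    (case k of 0 \<Rightarrow> 0 | Suc m \<Rightarrow> smult (1 / fact (Suc m)) (X * signed_eulerian m))"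
  unfolding increment_fps_def mult.assoc
  by (simp add: quotient_fps_def split: nat.split del: fact_Suc)

lemma fps_deriv_increment_fps: "fps_deriv increment_fps = flow_fps"
  unfolding fps_eq_iff fps_deriv_nth Suc_eq_plus1[symmetric] increment_fps_nth
  by (simp add: flow_fps_def of_nat_mult_smult_fact[unfolded mult_smult_right] del: of_nat_Suc
      fact_Suc)

text \<open>Since \<open>dw/dz = w / (1 + w) = X\<close>, this is the \<open>z\<close>-derivative of
  \<open>w(z + s) - w(z)\<close>.\<close>

lemma fps_pderiv_increment_fps: "fps_const (X * Y ^ 2) * fps_pderiv increment_fps =
    flow_fps - fps_const X"
proof -
  have "(fps_const (X * Y ^ 2) * fps_pderiv increment_fps) $ k = (flow_fps - fps_const X) $ k" for k
    by (cases k) (simp_all add: fps_pderiv_def increment_fps_nth flow_fps_def pderiv_smult mult_ac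
        del: fact_Suc)
  then show ?thesis by (simp add: fps_eq_iff)
qed

text \<open>This is \<open>w\<^sub>1 / (1 + w\<^sub>1) - w / (1 + w) = (w\<^sub>1 - w) / ((1 + w) (1 + w\<^sub>1))\<close>; there is no \<open>w\<close> in the
  polynomial ring, so it is obtained from the differential equation in \<open>s\<close>.\<close>

lemma flow_fps_minus_X: "flow_fps - fps_const X = increment_fps * fps_const Y * (1 - flow_fps)"
proof -
  \<comment> \<open>The claim says \<open>Z = 0\<close>. In terms of \<open>w\<close> the product is
    \<open>1 / (1 + w1)\<close> times \<open>(1 + w1) / (1 + w)\<close>, where
    \<open>w1 = w(z + s)\<close>.\<close>
  define Z where "Z = (1 - flow_fps) * (1 + increment_fps * fps_const Y) - fps_const Y"
  have c: "fps_const Y = 1 - fps_const X"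
    by (simp add: Y_def flip: fps_const_1_eq_1 fps_const_sub)
  have "fps_deriv Z = (- flow_fps * (1 - flow_fps)) * Z"
    unfolding Z_def by (simp add: fps_deriv_flow_fps_ode fps_deriv_increment_fps power2_eq_square
        algebra_simps)
  moreover have "Z $ 0 = 0" by (simp add: Z_def flow_fps_def increment_fps_def Y_def)
  ultimately have "Z = 0" by (rule fps_linear_ode_zero)
  then show ?thesis unfolding Z_def c by (simp add: algebra_simps)
qed

text \<open>Two expressions for \<open>flow_fps - fps_const X\<close> are available. Equating them,
  with \<open>increment_fps\<close> written as \<open>s X\<close> times \<open>quotient_fps\<close>,
  leaves common factors that cancel.\<close>

lemma fps_pderiv_quotient_fps: "fps_pderiv quotient_fps = - fps_X * quotient_fps ^ 2 *
    (1 - flow_fps)"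
proof -
  let ?x = "fps_const X" and ?y = "fps_const Y"
  have xy: "?x \<noteq> 0" "?y \<noteq> 0" by simp_all
  have c: "?y = 1 - ?x"
    by (simp add: Y_def flip: fps_const_1_eq_1 fps_const_sub)
  have "fps_pderiv increment_fps = fps_X * (quotient_fps + ?x * fps_pderiv quotient_fps)"
    unfolding increment_fps_def fps_pderiv_simps by (simp add: algebra_simps)
  then have "(?x * ?y * fps_X) * (?y * (quotient_fps + ?x * fps_pderiv quotient_fps)) =
      (?x * ?y * fps_X) * (quotient_fps * (1 - flow_fps))"
    using fps_pderiv_increment_fps flow_fps_minus_X
    by (simp add: increment_fps_def power2_eq_square algebra_simps flip: fps_const_mult)
  then have "?y * (quotient_fps + ?x * fps_pderiv quotient_fps) = quotient_fps * (1 - flow_fps)"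
    using xy by simp
  then have "?x * ?y * fps_pderiv quotient_fps = - quotient_fps * (flow_fps - ?x)"
    using c by algebra
  also have "\<dots> = ?x * ?y * (- fps_X * quotient_fps ^ 2 * (1 - flow_fps))"
    unfolding flow_fps_minus_X by (simp add: increment_fps_def power2_eq_square algebra_simps)
  finally have "?x * ?y * fps_pderiv quotient_fps =
      ?x * ?y * (- fps_X * quotient_fps ^ 2 * (1 - flow_fps))" .
  moreover have "?x * ?y \<noteq> 0" using xy by simp
  ultimately show ?thesis by (simp only: mult_cancel_left simp_thms)
qed

text \<open>The coefficients lie in a ring that is not a field. The series is invertible because its
  constant coefficient is 1; the second argument is the inverse of that coefficient.\<close>

definition recip_fps :: "real poly fps" where "recip_fps = fps_left_inverse quotient_fps 1"

lemma recip_fps_times_quotient_fps: "recip_fps * quotient_fps = 1"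
  unfolding recip_fps_def by (rule fps_left_inverse) (simp add: quotient_fps_def)

lemma fps_pderiv_recip_fps: "fps_pderiv recip_fps = fps_X * (1 - flow_fps)"
proof -
  have "recip_fps * fps_pderiv quotient_fps + fps_pderiv recip_fps * quotient_fps = 0"
    using arg_cong[OF recip_fps_times_quotient_fps, of fps_pderiv] by (simp add: fps_pderiv_simps)
  then have "fps_pderiv recip_fps * (recip_fps * quotient_fps) = - recip_fps * recip_fps *
      fps_pderiv quotient_fps"
    by algebra
  also have "\<dots> = fps_X * (1 - flow_fps) * (recip_fps * quotient_fps) ^ 2"
    unfolding fps_pderiv_quotient_fps by (simp add: power2_eq_square algebra_simps)
  finally show ?thesis by (simp add: recip_fps_times_quotient_fps)
qed

section \<open>End point values of \<open>recip_fps\<close> and the Bernoulli numbers\<close>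

lemma poly_recip_quotient_convolution:
    "(\<Sum>j\<le>k. poly (recip_fps $ j) a * poly (quotient_fps $ (k - j)) a) = (if k = 0 then 1 else 0)"
  using arg_cong[OF recip_fps_times_quotient_fps, of "\<lambda>f. poly (f $ k) a"]
  by (simp add: fps_mult_nth poly_sum atLeast0AtMost split: if_splits)

text \<open>At \<open>X = 1\<close> only the constant coefficient of \<open>quotient_fps\<close>
  survives, so its reciprocal is 1 there.\<close>

lemma poly_recip_fps_1: "k > 0 \<Longrightarrow> poly (recip_fps $ k) 1 = 0"
proof -
  assume k: "k > 0"
  have "(\<Sum>j\<le>k. poly (recip_fps $ j) 1 * poly (quotient_fps $ (k - j)) 1) =
      (\<Sum>j\<in>{k}. poly (recip_fps $ j) 1 * poly (quotient_fps $ (k - j)) 1)"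
    by (rule sum.mono_neutral_right) (auto simp: quotient_fps_def poly_signed_eulerian_1)
  then show ?thesis using poly_recip_quotient_convolution[of 1 k] k by (simp add: quotient_fps_def)
qed

lemma bernoulli_sum: "(\<Sum>j\<le>n. real (Suc n choose j) * bernoulli j) = real (Suc n)"
  by (cases n) (simp_all add: field_simps atLeast0AtMost del: of_nat_Suc binomial_Suc_Suc)

text \<open>At \<open>X = 0\<close> the series \<open>quotient_fps\<close> is
  \<open>(exp s - 1) / s\<close>. Its reciprocal generates the Bernoulli numbers with value
  \<open>- 1/2\<close> at index 1, which the last summand corrects to \<open>+ 1/2\<close>.\<close>

lemma bernoulli_eq: "bernoulli k = fact k * poly (recip_fps $ k) 0 + (if k = 1 then 1 else 0)"
proof (induction k rule: less_induct)
  case (less n)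
  let ?b = "\<lambda>j. fact j * poly (recip_fps $ j) 0"
  have "(\<Sum>j\<le>n. real (Suc n choose j) * ?b j) =
      (\<Sum>j\<le>n. fact (Suc n) * (poly (recip_fps $ j) 0 * poly (quotient_fps $ (n - j)) 0))"
    by (intro sum.cong refl)
        (simp add: binomial_fact quotient_fps_def poly_signed_eulerian_0 Suc_diff_le del: fact_Suc
            binomial_Suc_Suc)
  also have "\<dots> = (if n = 0 then 1 else 0)"
    unfolding sum_distrib_left[symmetric] poly_recip_quotient_convolution by simp
  \<comment> \<open>The correction at \<open>j = 1\<close> adds \<open>Suc n choose 1\<close> when
    \<open>n > 0\<close>; for \<open>n = 0\<close> that index is out of range and the sum is already
    1.\<close>
  finally have "(\<Sum>j\<le>n. real (Suc n choose j) * (?b j + (if j = 1 then 1 else 0))) = real (Suc n)"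
    by (simp add: distrib_left sum.distrib if_distrib[of "\<lambda>x. _ * x"] sum.delta del: of_nat_Suc
        binomial_Suc_Suc cong: if_cong)
  with bernoulli_sum[of n] have "(\<Sum>j\<le>n. real (Suc n choose j) * bernoulli j)
      = (\<Sum>j\<le>n. real (Suc n choose j) * (?b j + (if j = 1 then 1 else 0)))"
    by simp
  moreover have "(\<Sum>j<n. real (Suc n choose j) * bernoulli j)
      = (\<Sum>j<n. real (Suc n choose j) * (?b j + (if j = 1 then 1 else 0)))"
    by (intro sum.cong refl) (simp add: less)
  ultimately have "real (Suc n choose n) * bernoulli n =
      real (Suc n choose n) * (?b n + (if n = 1 then 1 else 0))"
    unfolding lessThan_Suc_atMost[symmetric] sum.lessThan_Suc by linarith
  then show ?case by (simp del: of_nat_Suc binomial_Suc_Suc)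
qed

text \<open>The coefficient of \<open>s ^ Suc k\<close> in \<open>fps_pderiv_recip_fps\<close> makes
  the integrand, up to a constant, a derivative. The end point values of \<open>recip_fps\<close>
  then give the integral.\<close>

lemma unit_integral_X_signed_eulerian: "unit_integral (X * signed_eulerian k) =
    bernoulli (Suc k) / real (Suc k)"
proof -
  have "pderiv (recip_fps $ Suc k) =
      (if k = 0 then 1 else 0) - smult (1 / fact k) (X * signed_eulerian k)"
    using arg_cong[OF fps_pderiv_recip_fps, of "\<lambda>f. f $ Suc k"]
    by (simp add: fps_pderiv_def flow_fps_def)
  then have "smult (1 / fact k) (X * signed_eulerian k) =
      smult (if k = 0 then 1 else 0) (X ^ 0 * Y ^ 0) - pderiv (recip_fps $ Suc k)"
    by simp
  then have "unit_integral (smult (1 / fact k) (X * signed_eulerian k)) =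
      (if k = 0 then 1 else 0) + poly (recip_fps $ Suc k) 0"
    by (simp only: unit_integral_diff unit_integral_smult unit_integral_beta unit_integral_pderiv
        poly_recip_fps_1) simp
  then have "unit_integral (X * signed_eulerian k) =
      fact k * ((if k = 0 then 1 else 0) + poly (recip_fps $ Suc k) 0)"
    by (simp add: unit_integral_smult field_simps)
  then show ?thesis
    by (simp add: bernoulli_eq field_simps del: bernoulli.simps)
qed

section \<open>The two identities\<close>

text \<open>The recursion sends \<open>X ^ j * Y ^ (2 * n - j)\<close> to two neighbouring monomials
  of degree \<open>2 * n + 2\<close>, with coefficients \<open>j + 1\<close> and
  \<open>- (2 * n - j)\<close>. Up to signs these are the weights in
  \<open>second_eulerian_Suc\<close>.\<close>

lemma signed_eulerian_eq: "signed_eulerian n =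
    (\<Sum>j\<le>n. smult ((-1) ^ j * real (second_eulerian n j)) (X ^ j * Y ^ (2 * n - j)))"
proof (induction n)
  case 0 then show ?case by (simp add: second_eulerian_0)
next
  case (Suc n)
  let ?e = "\<lambda>j. (-1) ^ j * real (second_eulerian n j)" and ?m = "\<lambda>j. X ^ j * Y ^ (2 * Suc n - j)"
  have step: "Y ^ 2 * pderiv (X * (X ^ j * Y ^ (2 * n - j))) =
      smult (real (j + 1)) (?m j) - smult (real (2 * n - j)) (?m (Suc j))" if "j \<le> n" for j
  proof -
    have "2 * Suc n - j = 2 * n - j + 2" using that by simp
    then have low: "Y ^ (2 * Suc n - j) = Y ^ (2 * n - j) * Y ^ 2" by (simp only: power_add)
    \<comment> \<open>If \<open>2 * n - j = 0\<close>, truncated subtraction makes the exponents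
      differ, but the coefficient is 0.\<close>
    have high: "smult (real (2 * n - j)) (Y ^ 2 * Y ^ (2 * n - j - 1)) =
        smult (real (2 * n - j)) (Y ^ (2 * Suc n - Suc j))"
    proof (cases "2 * n - j")
      case (Suc d)
      then have "2 * Suc n - Suc j = 2 + (2 * n - j - 1)" by simp
      then show ?thesis by (simp only: power_add)
    qed simp
    have "pderiv (X * (X ^ j * Y ^ (2 * n - j))) =
        X ^ Suc j * pderiv (Y ^ (2 * n - j)) + Y ^ (2 * n - j) * pderiv (X ^ Suc j)"
      using pderiv_mult[of "X ^ Suc j" "Y ^ (2 * n - j)"] by (simp only: power_Suc mult.assoc)
    also have "\<dots> = smult (real (j + 1)) (X ^ j * Y ^ (2 * n - j))
        - X ^ Suc j * smult (real (2 * n - j)) (Y ^ (2 * n - j - 1))"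
      by (simp only: pderiv_power pderiv_X pderiv_Y diff_Suc_1 Suc_eq_plus1)
          (simp add: mult.commute)
    finally have "Y ^ 2 * pderiv (X * (X ^ j * Y ^ (2 * n - j))) =
        smult (real (j + 1)) (X ^ j * (Y ^ (2 * n - j) * Y ^ 2))
        - X ^ Suc j * smult (real (2 * n - j)) (Y ^ 2 * Y ^ (2 * n - j - 1))"
      by (simp only: right_diff_distrib mult_smult_right mult_ac)
    then show ?thesis
      by (simp only: low high mult_smult_right)
  qed
  have "signed_eulerian (Suc n) =
      (\<Sum>j\<le>n. smult (?e j) (Y ^ 2 * pderiv (X * (X ^ j * Y ^ (2 * n - j)))))"
    by (simp add: Suc.IH sum_distrib_left pderiv_sum pderiv_smult)
  also have "\<dots> =
      (\<Sum>j\<le>n. smult (?e j) (smult (real (j + 1)) (?m j) - smult (real (2 * n - j)) (?m (Suc j))))"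
    by (intro sum.cong refl) (simp only: step atMost_iff)
  also have "\<dots> =
      (\<Sum>j\<le>n. smult (?e j * real (j + 1)) (?m j)) +
          (\<Sum>j\<le>n. smult (- ?e j * real (2 * n - j)) (?m (Suc j)))"
    unfolding sum.distrib[symmetric] by (intro sum.cong refl) (simp add: smult_diff_right)
  also have "(\<Sum>j\<le>n. smult (?e j * real (j + 1)) (?m j)) =
      (\<Sum>j\<le>Suc n. smult (?e j * real (j + 1)) (?m j))"
    by (simp add: second_eulerian_eq_0)
  also have "(\<Sum>j\<le>n. smult (- ?e j * real (2 * n - j)) (?m (Suc j)))
      = (\<Sum>j\<le>Suc n. smult (if j = 0 then 0 else - ?e (j - 1) * real (2 * n + 1 - j)) (?m j))"
    unfolding sum.atMost_Suc_shift by simp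
  also have "(\<Sum>j\<le>Suc n. smult (?e j * real (j + 1)) (?m j)) + \<dots>
      = (\<Sum>j\<le>Suc n. smult ((-1) ^ j * real (second_eulerian (Suc n) j)) (?m j))"
    unfolding sum.distrib[symmetric] smult_add_left[symmetric]
  proof (intro sum.cong refl arg_cong2[of _ _ _ _ smult])
    fix j
    show "?e j * real (j + 1) + (if j = 0 then 0 else - ?e (j - 1) * real (2 * n + 1 - j)) =
        (-1) ^ j * real (second_eulerian (Suc n) j)"
      by (cases j) (simp_all add: second_eulerian_Suc distrib_left distrib_right mult_ac)
  qed
  finally show ?case .
qed

text \<open>Dividing \<open>signed_eulerian n\<close> by \<open>Y\<close> lowers the total degree to
  \<open>2 * n - 1\<close>, as the binomials require. By parts, the quotient \<open>Q\<close> has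
  integral \<open>bernoulli n / n\<close>; termwise its integral is the sum divided by
  \<open>2 * n\<close>.\<close>

lemma sum_second_eulerian_eq_bernoulli:
  assumes "n \<ge> 1"
  shows "(\<Sum>j = 0..n - 1. (-1) ^ j / real ((2 * n - 1) choose j) * real (second_eulerian n j)) =
      2 * bernoulli n"
proof -
  obtain m where n: "n = Suc m" using assms by (cases n) auto
  define Q where "Q = (\<Sum>j\<le>m. smult ((-1) ^ j * real (second_eulerian n j))
      (X ^ j * Y ^ (2 * n - 1 - j)))"
  have "Y * Q = signed_eulerian n"
  proof -
    have "Y * Q = (\<Sum>j\<le>m. smult ((-1) ^ j * real (second_eulerian n j)) (X ^ j * Y ^ (2 * n - j)))"
      unfolding Q_def sum_distrib_left
    proof (intro sum.cong refl)
      fix j assume "j \<in> {..m}"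
      then have "2 * n - j = Suc (2 * n - 1 - j)" by (simp add: n)
      then show "Y * smult ((-1) ^ j * real (second_eulerian n j)) (X ^ j * Y ^ (2 * n - 1 - j)) =
          smult ((-1) ^ j * real (second_eulerian n j)) (X ^ j * Y ^ (2 * n - j))"
        by (simp only: power_Suc mult_smult_right mult.left_commute)
    qed
    also have "\<dots> = signed_eulerian n"
      unfolding signed_eulerian_eq using second_eulerian_same[of n] by (simp add: n)
    finally show ?thesis .
  qed
  then have "Y * Q = Y * (Y * pderiv (X * signed_eulerian m))"
    by (simp add: n power2_eq_square mult.assoc)
  \<comment> \<open>The last term compensates for \<open>pderiv Y = - 1\<close>; the differentiated
    product vanishes at 0 and 1.\<close>
  then have "Q = pderiv (Y * (X * signed_eulerian m)) + X * signed_eulerian m"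
    unfolding pderiv_mult[of Y] by simp
  then have "unit_integral Q = bernoulli n / real n"
    by (simp only: unit_integral_add unit_integral_pderiv unit_integral_X_signed_eulerian n) simp
  moreover have "unit_integral Q =
      (\<Sum>j\<le>m. (-1) ^ j / real ((2 * n - 1) choose j) * real (second_eulerian n j)) / (2 * real n)"
    unfolding Q_def unit_integral_sum unit_integral_smult sum_divide_distrib
  proof (intro sum.cong refl)
    fix j assume "j \<in> {..m}"
    then have "j + (2 * n - 1 - j) = 2 * n - 1" by (simp add: n)
    moreover have "real (2 * n - 1 + 1) = 2 * real n" by (simp add: n)
    ultimately show "(-1) ^ j * real (second_eulerian n j) *
        unit_integral (X ^ j * Y ^ (2 * n - 1 - j)) =
        (-1) ^ j / real ((2 * n - 1) choose j) * real (second_eulerian n j) / (2 * real n)"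
      by (simp only: unit_integral_beta) simp
  qed
  moreover have "real n \<noteq> 0" and "{0..n - 1} = {..m}" using n by auto
  ultimately show ?thesis by (simp add: field_simps)
qed

text \<open>The exponents add up to \<open>2 * n - 1\<close>, so the beta integral turns this into
  the sum of the second identity.\<close>

definition shifted_eulerian :: "nat \<Rightarrow> real poly" where
  "shifted_eulerian n =
      (\<Sum>j = 1..n - 1. smult ((-1) ^ (j - 1) * real (second_eulerian n j))
          (X ^ (j - 1) * Y ^ (2 * n - j)))"

lemma X_times_shifted_eulerian: "X * shifted_eulerian n = Y ^ (2 * n) - signed_eulerian n"
proof (cases n)
  case 0 then show ?thesis by (simp add: shifted_eulerian_def)
next
  case (Suc m)
  let ?t = "\<lambda>j. smult ((-1) ^ j * real (second_eulerian n j)) (X ^ j * Y ^ (2 * n - j))"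
  have "X * shifted_eulerian n = (\<Sum>j = 1..m. - ?t j)"
    unfolding shifted_eulerian_def sum_distrib_left Suc diff_Suc_1
  proof (intro sum.cong refl)
    fix j assume "j \<in> {1..m}"
    then obtain i where "j = Suc i" by (cases j) auto
    then show "X * smult ((-1) ^ (j - 1) * real (second_eulerian (Suc m) j))
        (X ^ (j - 1) * Y ^ (2 * Suc m - j)) =
        - smult ((-1) ^ j * real (second_eulerian (Suc m) j)) (X ^ j * Y ^ (2 * Suc m - j))"
      by (simp add: mult.assoc)
  qed
  moreover have "signed_eulerian n = ?t 0 + (\<Sum>j = 1..m. ?t j)"
    unfolding signed_eulerian_eq using second_eulerian_same[of n]
    by (simp add: Suc sum.atLeast1_atMost_eq sum.atMost_shift)
  moreover have "?t 0 = Y ^ (2 * n)" by (simp add: second_eulerian_0_right)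
  ultimately show ?thesis by (simp add: sum_negf)
qed

text \<open>After multiplication by \<open>X\<close> this is the recursion of
  \<open>signed_eulerian\<close>. The form is chosen so that every term on the right has a known
  integral.\<close>

lemma shifted_eulerian_Suc: "shifted_eulerian (Suc n) - shifted_eulerian n =
    X * signed_eulerian n - pderiv (Y ^ 2 * signed_eulerian n) - Y ^ (2 * n) - Y ^ (2 * n + 1)"
proof -
  have y: "Y ^ (2 * Suc n) = Y ^ 2 * Y ^ (2 * n)" "Y ^ (2 * n + 1) = Y * Y ^ (2 * n)"
    by (simp_all add: power_add power2_eq_square)
  have c: "pderiv (Y ^ 2 * signed_eulerian n) =
      Y ^ 2 * pderiv (signed_eulerian n) - 2 * Y * signed_eulerian n"
    by (simp add: pderiv_mult power2_eq_square algebra_simps)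
  have "X * (shifted_eulerian (Suc n) - shifted_eulerian n) =
      Y ^ (2 * Suc n) - signed_eulerian (Suc n) - (Y ^ (2 * n) - signed_eulerian n)"
    by (simp only: right_diff_distrib X_times_shifted_eulerian)
  also have "\<dots> =
      X * (X * signed_eulerian n - pderiv (Y ^ 2 * signed_eulerian n) - Y ^ (2 * n) -
          Y ^ (2 * n + 1))"
    unfolding y c signed_eulerian.simps pderiv_mult[of X] pderiv_X
    by (simp add: Y_def algebra_simps power2_eq_square)
  finally show ?thesis by simp
qed

lemma unit_integral_shifted_eulerian:
  "unit_integral (shifted_eulerian n) = 1 / (2 * real n) *
     (\<Sum>j = 1..n - 1. (-1) ^ (j - 1) / real ((2 * n - 1) choose (j - 1)) *
         real (second_eulerian n j))"
  unfolding shifted_eulerian_def unit_integral_sum unit_integral_smult sum_distrib_left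
proof (intro sum.cong refl)
  fix j assume "j \<in> {1..n - 1}"
  then have "j - 1 + (2 * n - j) = 2 * n - 1" "real (2 * n - 1 + 1) = 2 * real n" by auto
  then show "(-1) ^ (j - 1) * real (second_eulerian n j) *
      unit_integral (X ^ (j - 1) * Y ^ (2 * n - j)) =
      1 / (2 * real n) * ((-1) ^ (j - 1) / real ((2 * n - 1) choose (j - 1)) *
          real (second_eulerian n j))"
    by (simp only: unit_integral_beta) simp
qed

lemma unit_integral_Y_power: "unit_integral (Y ^ k) = 1 / (real k + 1)"
  using unit_integral_beta[of 0 k] by (simp add: add.commute)

lemma sum_bernoulli_over_index:
  "(\<Sum>j = 1..n. bernoulli j / real j) = harm (2 * n) - real n + unit_integral (shifted_eulerian n)"
proof (induction n)
  case 0 then show ?case by (simp add: shifted_eulerian_def unit_integral_0 harm_def)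
next
  case (Suc n)
  \<comment> \<open>The summand 1 is the value of \<open>Y ^ 2 * signed_eulerian n\<close> at 0. The
    two fractions are the integrals of the powers of \<open>Y\<close> and extend the harmonic
    sum.\<close>
  have "unit_integral (shifted_eulerian (Suc n)) - unit_integral (shifted_eulerian n) =
      bernoulli (Suc n) / real (Suc n) + 1 - 1 / (real (2 * n) + 1) - 1 / (real (2 * n + 1) + 1)"
    unfolding unit_integral_diff[symmetric] shifted_eulerian_Suc
    unfolding unit_integral_diff unit_integral_X_signed_eulerian unit_integral_pderiv
        unit_integral_Y_power
    by (simp add: poly_signed_eulerian_0)
  moreover have "harm (2 * Suc n) =
      harm (2 * n) + 1 / (real (2 * n) + 1) + 1 / (real (2 * n + 1) + 1)"
    by (simp add: harm_Suc inverse_eq_divide add_ac)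
  ultimately show ?case using Suc.IH by (simp del: bernoulli.simps)
qed

theorem theorem1p1:
  fixes n :: nat
  assumes "n \<ge> 1"
  shows "2 * bernoulli n =
           (\<Sum>j = 0..n - 1. (-1) ^ j / real ((2 * n - 1) choose j) * real (second_eulerian n j)) \<and>
         (\<Sum>j = 1..n. bernoulli j / real j) =
           harm (2 * n) - real n +
           1 / (2 * real n) *
           (\<Sum>j = 1..n - 1. (-1) ^ (j - 1) / real ((2 * n - 1) choose (j - 1)) * real (second_eulerian n j))"
  using sum_second_eulerian_eq_bernoulli[OF assms] sum_bernoulli_over_index[of n]
  unfolding unit_integral_shifted_eulerian by simp

end
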